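(* Let $(N,v)$ be an uncapacitated production-distribution game with market set $M$, demands $d_{ij}$ and per-unit profits $\alpha_{ij}$, and for each $j\in M$ let $v_j(S)=\big(\sum_{i\in S}d_{ij}\big)\cdot\alpha^S_j$ for $S\subseteq N$, where $\alpha_j^S=\max_{k\in S}\alpha_{kj}$. The following assertions are equivalent: (i) the core of $(N,v)$ is a singleton; (ii) for each $j\in M$, the core of $(N,v_j)$ is a singleton; (iii) for all $j\in M$, $i\in N$ and $k\in N\setminus\{i\}$, we have $d_{kj}\cdot\big(\alpha_j^N-\alpha_j^{N\setminus\{i\}}\big)=0$.
   Context: Uncapacitated production-distribution game: let $N=\{1,\dots,n\}$ (players) and $M=\{1,\dots,m\}$ (markets), $n,m\ge1$, with per-unit profits $\alpha_{ij}\ge 0$ and demands $d_{ij}\ge 0$ for $i\in N$, $j\in M$. The value of a nonempty coalition $S\subseteq N$ is $$v(S)=\sum_{j\in M}\Big(\sum_{i\in S}d_{ij}\Big)\cdot\max_{k\in S}\alpha_{kj},$$ and $v(\emptyset)=0$. (This is the maximum profit obtainable by $S$ by redistributing its members' total demand in each market among its members when production capacities are not binding.) Likewise $v_j(\emptyset)=0$, and $v=\sum_{j\in M}v_j$. For $x\in\mathbb{R}^n$ and $S\subseteq N$ write $x(S)=\sum_{i\in S}x_i$. The core of a game $(N,w)$ is the set of $x\in\mathbb{R}^n$ with $x(N)=w(N)$ and $x(S)\ge w(S)$ for all $S\subseteq N$. *)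

theory Defs
  imports "HOL-Analysis.Finite_Cartesian_Product"
begin

text \<open>
  The player set \<open>N\<close> is the finite type \<open>'n\<close> and the market set \<open>M\<close> the finite type \<open>'m\<close>;
  types are nonempty, so \<open>n, m \<ge> 1\<close>. Coalitions are sets \<open>S :: 'n set\<close>, with \<open>N = UNIV\<close>,
  and payoff vectors are elements of \<open>real ^ 'n\<close>.
\<close>

definition core :: "('n::finite set \<Rightarrow> real) \<Rightarrow> (real ^ 'n) set" where
  "core w = {x. (\<Sum>i\<in>UNIV. x $ i) = w UNIV \<and> (\<forall>S. (\<Sum>i\<in>S. x $ i) \<ge> w S)}"

text \<open>\<open>max_profit \<alpha> S j\<close> is $\alpha_j^S$; it is unspecified for \<open>S = {}\<close>.\<close>

definition max_profit :: "('n::finite \<Rightarrow> 'm::finite \<Rightarrow> real) \<Rightarrow> 'n set \<Rightarrow> 'm \<Rightarrow> real" where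
  "max_profit \<alpha> S j = Max ((\<lambda>k. \<alpha> k j) ` S)"

definition market_game ::
  "('n::finite \<Rightarrow> 'm::finite \<Rightarrow> real) \<Rightarrow> ('n \<Rightarrow> 'm \<Rightarrow> real) \<Rightarrow> 'm \<Rightarrow> 'n set \<Rightarrow> real" where
  "market_game \<alpha> d j S = (\<Sum>i\<in>S. d i j) * max_profit \<alpha> S j"

definition pd_game ::
  "('n::finite \<Rightarrow> 'm::finite \<Rightarrow> real) \<Rightarrow> ('n \<Rightarrow> 'm \<Rightarrow> real) \<Rightarrow> 'n set \<Rightarrow> real" where
  "pd_game \<alpha> d S = (\<Sum>j\<in>UNIV. (\<Sum>i\<in>S. d i j) * max_profit \<alpha> S j)"

text \<open>
  The empty coalition needs no separate clause: its total demand is the empty sum, so its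
  value is \<open>0\<close> whatever \<open>Max {}\<close> is.
\<close>

lemma market_game_empty: "market_game \<alpha> d j {} = 0"
  by (simp add: market_game_def)

lemma pd_game_empty: "pd_game \<alpha> d {} = 0"
  by (simp add: pd_game_def)

lemma pd_game_eq_sum_market_game: "pd_game \<alpha> d S = (\<Sum>j\<in>UNIV. market_game \<alpha> d j S)"
  by (simp add: pd_game_def market_game_def)

end

theory Submission
  imports Defs
begin

text \<open>
  Paying every player \<open>i\<close> the amount \<open>d i j * \<alpha>\<^sub>j\<^sup>N\<close> in market \<open>j\<close> is a core allocation of that
  market, and sums of core allocations of the markets are core allocations of the whole game;
  hence uniqueness in the whole game forces uniqueness in each market. If a player \<open>i\<close> is
  indispensable in market \<open>j\<close>, in the sense that \<open>\<alpha>\<^sub>j\<close> drops when \<open>i\<close> leaves, then any \<open>k \<noteq> i\<close>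
  with positive demand can hand the amount lost, \<open>d k j\<close> times the drop, over to \<open>i\<close>: this is a
  second core allocation. If nobody loses anything when \<open>i\<close> leaves, the coalition \<open>N - {i}\<close> is
  tight at the canonical allocation for every \<open>i\<close>, which bounds each player's payoff from above
  and so pins down the core.
\<close>

lemma mem_core_iff:
  "x \<in> core w \<longleftrightarrow> (\<Sum>i\<in>UNIV. x $ i) = w UNIV \<and> (\<forall>S. w S \<le> (\<Sum>i\<in>S. x $ i))"
  by (simp add: core_def)

text \<open>Efficiency and the coalition bounds are linear in payoff vector and game jointly, so
  they add up.\<close>

lemma core_sum:
  assumes "\<And>j. j \<in> J \<Longrightarrow> f j \<in> core (w j)"
  shows "(\<Sum>j\<in>J. f j) \<in> core (\<lambda>S. \<Sum>j\<in>J. w j S)"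
proof -
  have eq: "(\<Sum>i\<in>S. (\<Sum>j\<in>J. f j) $ i) = (\<Sum>j\<in>J. \<Sum>i\<in>S. f j $ i)" for S
    unfolding sum_component by (rule sum.swap)
  show ?thesis
    unfolding mem_core_iff eq using assms by (auto simp: mem_core_iff intro!: sum.cong sum_mono)
qed

text \<open>Any core element \<open>y\<close> pays \<open>UNIV - {i}\<close> at least its worth,
  which \<open>x\<close> pays exactly; as the totals agree, \<open>y $ i \<le> x $ i\<close>. Equal
  totals then force equality in every coordinate.\<close>

lemma core_eq_singleton:
  assumes x: "x \<in> core w"
    and tight: "\<And>i. (\<Sum>k\<in>UNIV - {i}. x $ k) = w (UNIV - {i})"
  shows "core w = {x}"
proof -
  have "y = x" if y: "y \<in> core w" for y
  proof -
    have tot: "(\<Sum>k\<in>UNIV. y $ k) = (\<Sum>k\<in>UNIV. x $ k)"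
      using x y by (simp add: mem_core_iff)
    have le: "y $ i \<le> x $ i" for i
    proof -
      have "(\<Sum>k\<in>UNIV - {i}. x $ k) \<le> (\<Sum>k\<in>UNIV - {i}. y $ k)"
        using y tight[of i] by (simp add: mem_core_iff)
      with tot show ?thesis by (simp add: sum.remove[of UNIV i])
    qed
    have "(\<Sum>k\<in>UNIV. x $ k - y $ k) = 0"
      using tot by (simp add: sum_subtractf)
    then have "\<forall>k\<in>UNIV. x $ k - y $ k = 0"
      using le by (subst (asm) sum_nonneg_eq_0_iff) auto
    then show ?thesis by (simp add: vec_eq_iff)
  qed
  with x show ?thesis by blast
qed

lemma max_profit_mono:
  assumes "S \<noteq> {}" "S \<subseteq> T"
  shows "max_profit \<alpha> S j \<le> max_profit \<alpha> T j"
  unfolding max_profit_def using assms by (intro Max_mono) auto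

definition market_alloc ::
  "('n::finite \<Rightarrow> 'm::finite \<Rightarrow> real) \<Rightarrow> ('n \<Rightarrow> 'm \<Rightarrow> real) \<Rightarrow> 'm \<Rightarrow> real ^ 'n" where
  "market_alloc \<alpha> d j = (\<chi> i. d i j * max_profit \<alpha> UNIV j)"

lemma sum_market_alloc:
  "(\<Sum>i\<in>S. market_alloc \<alpha> d j $ i) = (\<Sum>i\<in>S. d i j) * max_profit \<alpha> UNIV j"
  by (simp add: market_alloc_def sum_distrib_right)

lemma market_game_mono_profit:
  assumes "\<And>i. 0 \<le> d i j" "S \<subseteq> T"
  shows "market_game \<alpha> d j S \<le> (\<Sum>i\<in>S. d i j) * max_profit \<alpha> T j"
  using assms
  \<comment> \<open>For \<open>S = {}\<close> both sides are 0; \<open>max_profit\<close> is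
    unspecified there, so monotonicity covers only nonempty \<open>S\<close>.\<close>
  by (cases "S = {}")
     (auto simp: market_game_def intro!: mult_left_mono max_profit_mono sum_nonneg)

lemma market_alloc_in_core:
  assumes "\<And>i. 0 \<le> d i j"
  shows "market_alloc \<alpha> d j \<in> core (market_game \<alpha> d j)"
  unfolding mem_core_iff sum_market_alloc
  using market_game_mono_profit[of d j, OF assms] by (auto simp: market_game_def)

text \<open>Only coalitions containing \<open>k\<close> but not \<open>i\<close> lose
  \<open>e\<close>. They earn at most the reduced unit profit of \<open>UNIV - {i}\<close>, and
  their demand is at least \<open>d k j\<close>, so their slack at \<open>market_alloc\<close> is at
  least \<open>e\<close>.\<close>

lemma transfer_in_core:
  fixes \<alpha> d :: "'n::finite \<Rightarrow> 'm::finite \<Rightarrow> real"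
  assumes d: "\<And>i. 0 \<le> d i j" and "k \<noteq> i"
  defines "e \<equiv> d k j * (max_profit \<alpha> UNIV j - max_profit \<alpha> (UNIV - {i}) j)"
  shows "market_alloc \<alpha> d j + axis i e - axis k e \<in> core (market_game \<alpha> d j)"
    (is "?y \<in> _")
proof -
  let ?D = "\<lambda>S. \<Sum>l\<in>S. d l j"
  let ?a = "max_profit \<alpha> UNIV j" and ?b = "max_profit \<alpha> (UNIV - {i}) j"
  have sum_y: "(\<Sum>l\<in>S. ?y $ l) =
      ?D S * ?a + (if i \<in> S then e else 0) - (if k \<in> S then e else 0)" for S
    by (simp add: sum.distrib sum_subtractf sum_market_alloc axis_def sum.delta')
  \<comment> \<open>Since \<open>k \<noteq> i\<close>, the set \<open>UNIV - {i}\<close> is nonempty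
    and its maximum is genuine.\<close>
  have ba: "?b \<le> ?a"
    using \<open>k \<noteq> i\<close> by (intro max_profit_mono) auto
  then have e: "0 \<le> e"
    using d by (simp add: e_def)
  have "market_game \<alpha> d j S \<le> (\<Sum>l\<in>S. ?y $ l)" for S
  proof (cases "k \<in> S \<and> i \<notin> S")
    case True
    then have "market_game \<alpha> d j S \<le> ?D S * ?b"
      by (intro market_game_mono_profit d) auto
    also have "\<dots> = ?D S * ?a - ?D S * (?a - ?b)"
      by (simp add: algebra_simps)
    also have "\<dots> \<le> ?D S * ?a - e"
    proof -
      have "d k j \<le> ?D S"
        using True d by (intro member_le_sum) auto
      then show ?thesis
        using ba by (simp add: e_def mult_right_mono)
    qed
    finally show ?thesis
      \<comment> \<open>The component rules would split \<open>?y $ l\<close> before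
        \<open>sum_y\<close> can match.\<close>
      using True by (simp add: sum_y del: vector_minus_component vector_add_component)
  next
    case False
    have "market_game \<alpha> d j S \<le> ?D S * ?a"
      by (intro market_game_mono_profit d) auto
    with False e show ?thesis
      by (auto simp: sum_y simp del: vector_minus_component vector_add_component)
  qed
  moreover have "(\<Sum>l\<in>UNIV. ?y $ l) = market_game \<alpha> d j UNIV"
    by (simp add: sum_y market_game_def del: vector_minus_component vector_add_component)
  ultimately show ?thesis
    by (simp add: mem_core_iff del: vector_minus_component vector_add_component)
qed

lemma is_singleton_eq: "is_singleton A \<Longrightarrow> x \<in> A \<Longrightarrow> y \<in> A \<Longrightarrow> x = y"
  by (auto simp: is_singleton_def)

lemma market_core_singleton_imp_no_drop:
  assumes "\<And>i. 0 \<le> d i j" and "is_singleton (core (market_game \<alpha> d j))" and "k \<noteq> i"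
  shows "d k j * (max_profit \<alpha> UNIV j - max_profit \<alpha> (UNIV - {i}) j) = 0" (is "?e = 0")
proof -
  have "market_alloc \<alpha> d j + axis i ?e - axis k ?e = market_alloc \<alpha> d j"
    using assms(2) transfer_in_core[of d j, OF assms(1,3)] market_alloc_in_core[of d j, OF assms(1)]
    by (rule is_singleton_eq)
  then have "(market_alloc \<alpha> d j + axis i ?e - axis k ?e) $ i = market_alloc \<alpha> d j $ i"
    by (rule arg_cong)
  with \<open>k \<noteq> i\<close> show ?thesis
    by (simp add: axis_def)
qed

lemma pd_game_eq: "pd_game \<alpha> d = (\<lambda>S. \<Sum>j\<in>UNIV. market_game \<alpha> d j S)"
  by (simp add: fun_eq_iff pd_game_eq_sum_market_game)

lemma pd_core_singleton_imp_market:
  assumes d: "\<And>i j. 0 \<le> d i j" and single: "is_singleton (core (pd_game \<alpha> d))"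
  shows "is_singleton (core (market_game \<alpha> d j))"
proof (rule is_singletonI')
  show "core (market_game \<alpha> d j) \<noteq> {}"
    using market_alloc_in_core[of d j] d by blast
next
  fix x y assume xy: "x \<in> core (market_game \<alpha> d j)" "y \<in> core (market_game \<alpha> d j)"
  \<comment> \<open>\<open>f z\<close> uses \<open>z\<close> in market \<open>j\<close> and the
    canonical allocation elsewhere, so the totals for \<open>x\<close> and \<open>y\<close> differ
    only in the term for \<open>j\<close>.\<close>
  define f where "f z = (market_alloc \<alpha> d)(j := z)" for z
  have "(\<Sum>l\<in>UNIV. f z l) \<in> core (pd_game \<alpha> d)" if "z \<in> core (market_game \<alpha> d j)" for z
    unfolding pd_game_eq using that
    by (intro core_sum) (auto simp: f_def intro: market_alloc_in_core d)
  with single xy have "(\<Sum>l\<in>UNIV. f x l) = (\<Sum>l\<in>UNIV. f y l)"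
    by (blast intro: is_singleton_eq)
  then show "x = y"
    by (simp add: f_def sum.remove[of UNIV j])
qed

lemma no_drop_imp_pd_core_singleton:
  assumes d: "\<And>i j. 0 \<le> d i j"
    and no_drop: "\<And>j i k. k \<noteq> i \<Longrightarrow>
      d k j * (max_profit \<alpha> UNIV j - max_profit \<alpha> (UNIV - {i}) j) = 0"
  shows "is_singleton (core (pd_game \<alpha> d))"
proof -
  let ?x = "\<Sum>j\<in>UNIV. market_alloc \<alpha> d j"
  have "core (pd_game \<alpha> d) = {?x}"
  proof (rule core_eq_singleton)
    show "?x \<in> core (pd_game \<alpha> d)"
      unfolding pd_game_eq using d by (intro core_sum market_alloc_in_core)
  next
    fix i
    have "(\<Sum>k\<in>UNIV - {i}. ?x $ k) = (\<Sum>j\<in>UNIV. \<Sum>k\<in>UNIV - {i}. market_alloc \<alpha> d j $ k)"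
      unfolding sum_component by (rule sum.swap)
    also have "\<dots> = (\<Sum>j\<in>UNIV. market_game \<alpha> d j (UNIV - {i}))"
    proof (rule sum.cong[OF refl])
      fix j
      \<comment> \<open>With a single player \<open>UNIV - {i}\<close> is empty: this is vacuous,
        and both sums below are 0 whatever \<open>max_profit\<close> is on
        \<open>{}\<close>.\<close>
      have "d k j * max_profit \<alpha> UNIV j = d k j * max_profit \<alpha> (UNIV - {i}) j"
        if "k \<in> UNIV - {i}" for k
        using no_drop[of k i j] that by (auto simp: algebra_simps)
      then show "(\<Sum>k\<in>UNIV - {i}. market_alloc \<alpha> d j $ k) = market_game \<alpha> d j (UNIV - {i})"
        unfolding market_alloc_def market_game_def sum_distrib_right vec_lambda_beta
        by (rule sum.cong[OF refl])
    qed
    finally show "(\<Sum>k\<in>UNIV - {i}. ?x $ k) = pd_game \<alpha> d (UNIV - {i})"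
      by (simp only: pd_game_eq)
  qed
  then show ?thesis by simp
qed

theorem lemma3:
  fixes \<alpha> d :: "'n::finite \<Rightarrow> 'm::finite \<Rightarrow> real"
  assumes "\<And>i j. \<alpha> i j \<ge> 0" and "\<And>i j. d i j \<ge> 0"
  shows "(is_singleton (core (pd_game \<alpha> d)) \<longleftrightarrow>
           (\<forall>j. is_singleton (core (market_game \<alpha> d j)))) \<and>
         ((\<forall>j. is_singleton (core (market_game \<alpha> d j))) \<longleftrightarrow>
           (\<forall>j i. \<forall>k\<in>UNIV - {i}.
              d k j * (max_profit \<alpha> UNIV j - max_profit \<alpha> (UNIV - {i}) j) = 0))"
    (is "(?i \<longleftrightarrow> ?ii) \<and> (_ \<longleftrightarrow> ?iii)")
proof -
  have "?i \<Longrightarrow> ?ii"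
    using pd_core_singleton_imp_market[of d] assms(2) by blast
  moreover have "?ii \<Longrightarrow> ?iii"
    using market_core_singleton_imp_no_drop[of d] assms(2) by blast
  moreover have "?iii \<Longrightarrow> ?i"
    using assms(2) by (intro no_drop_imp_pd_core_singleton) auto
  ultimately show ?thesis by blast
qed

end
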